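(* Let $q$ be a complex number with $|q|<1$. Let $$\omega(q):=\sum_{n=0}^{\infty}\frac{q^{2n^2+2n}}{(q;q^2)_{n+1}^2},\qquad \nu(q):=\sum_{n=0}^{\infty}\frac{q^{n^2+n}}{(-q;q^2)_{n+1}},\qquad \psi(q):=\sum_{n=0}^{\infty}q^{\binom{n+1}{2}}.$$ Then $$\sum_{n=0}^{\infty}q^n(-q^{n+1};q)_n(-q^{2n+2};q^2)_{\infty}=q\,\omega(q^2)+(-q^2;q^2)_{\infty}\,\psi(q^2)=\nu(-q).$$
   Context: Notation: $(a;q)_n:=\prod_{j=0}^{n-1}(1-aq^j)$ for $n\ge 0$ (empty product equal to 1) and $(a;q)_\infty:=\lim_{n\to\infty}(a;q)_n$. One also has $\psi(q)=(q^2;q^2)_\infty/(q;q^2)_\infty$. *)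

theory Defs
  imports Complex_Main
begin

definition qpoch :: "complex \<Rightarrow> complex \<Rightarrow> nat \<Rightarrow> complex" where
  "qpoch a q n = (\<Prod>j<n. 1 - a * q ^ j)"

definition qpoch_inf :: "complex \<Rightarrow> complex \<Rightarrow> complex" where
  "qpoch_inf a q = lim (\<lambda>n. qpoch a q n)"

text \<open>
  The three series below converge whenever \<open>norm q < 1\<close>; in that range the denominators of
  \<open>omega\<close> and \<open>nu\<close> are nonzero.
\<close>

definition omega :: "complex \<Rightarrow> complex" where
  "omega q = (\<Sum>n. q ^ (2 * n\<^sup>2 + 2 * n) / (qpoch q (q\<^sup>2) (n + 1))\<^sup>2)"

definition nu :: "complex \<Rightarrow> complex" where
  "nu q = (\<Sum>n. q ^ (n\<^sup>2 + n) / qpoch (- q) (q\<^sup>2) (n + 1))"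

definition psi :: "complex \<Rightarrow> complex" where
  "psi q = (\<Sum>n. q ^ ((n + 1) choose 2))"

end

theory Submission
  imports Defs "HOL-Analysis.Infinite_Products" "HOL-Analysis.Uniform_Limit"
begin

text \<open>
  Put \<open>G z x = (\<Sum>n. z ^ n * Q ^ (n * (n + 1) / 2) / (x; Q)_(n + 1))\<close> with \<open>Q = q\<^sup>2\<close>, so that
  \<open>nu (- q) = G 1 q\<close>. Comparing consecutive terms gives two functional equations,
  \<open>G z x = 1 + (x + z * Q) * G (z * Q) x\<close> and \<open>(1 - x\<^sup>2) * G 1 x = G 1 (x * Q) + x\<close>.

  Iterating the second one yields
  \<open>G 1 x = x * (\<Sum>k. Q ^ k / (x\<^sup>2; Q\<^sup>2)_(k + 1)) + psi Q / (x\<^sup>2; Q\<^sup>2)_\<infinity>\<close>. At \<open>x = q\<close> the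
  product is handled by Euler's \<open>(Q; Q\<^sup>2)_\<infinity> * (- Q; Q)_\<infinity> = 1\<close>, and the series is \<open>omega Q\<close> by the
  case \<open>t = y = Q\<close>, \<open>p = Q\<^sup>2\<close> of
  \<open>(\<Sum>n. t ^ n / (y; p)_(n + 1)) = (\<Sum>n. (t * y) ^ n * p ^ n\<^sup>2 / ((t; p)_(n + 1) * (y; p)_(n + 1)))\<close>,
  which again comes from iterating a functional equation.

  The series over distinct parts is the value at \<open>z = 1\<close> of
  \<open>F z = (\<Sum>n. q ^ n * (- z * q ^ (n + 1); q)_n * (- z * q ^ (2 * n + 2); Q)_\<infinity>)\<close>. By telescoping
  \<open>(- w * q ^ n; q)_n * (- w * q ^ (2 * n); Q)_\<infinity>\<close> with \<open>w = z * Q\<close>, \<open>F\<close> satisfies the first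
  functional equation of \<open>G z q\<close>, and a bounded solution of it is unique.
\<close>

subsection \<open>The q-Pochhammer symbol\<close>

lemma qpoch_0 [simp]: "qpoch a q 0 = 1"
  by (simp add: qpoch_def)

lemma qpoch_Suc: "qpoch a q (Suc n) = qpoch a q n * (1 - a * q ^ n)"
  by (simp add: qpoch_def)

lemma qpoch_Suc_shift: "qpoch a q (Suc n) = (1 - a) * qpoch (a * q) q n"
  unfolding qpoch_def by (subst prod.lessThan_Suc_shift) (simp add: algebra_simps)

section \<open>Bounds on finite products, uniform in the number of factors\<close>

lemma sum_geometric_le:
  fixes r :: real
  assumes "0 \<le> r" "r < 1"
  shows "(\<Sum>j<n. r ^ j) \<le> 1 / (1 - r)"
proof -
  have "(\<Sum>j<n. r ^ j) \<le> (\<Sum>j. r ^ j)"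
    using assms by (intro sum_le_suminf summable_geometric) auto
  then show ?thesis
    using assms by (simp add: suminf_geometric)
qed

text \<open>From \<open>1 + t \<le> exp t\<close> and the geometric series. The bound is free of
  \<open>n\<close> and tends to 0 with \<open>a\<close>; both features are needed when
  \<open>a\<close> and \<open>n\<close> vary together.\<close>

lemma norm_qpoch_minus_1_le:
  assumes "norm q < 1"
  shows "norm (qpoch a q n - 1) \<le> exp (norm a / (1 - norm q)) - 1"
proof -
  have "norm (qpoch a q n - 1) = norm ((\<Prod>j<n. 1 + - (a * q ^ j)) - 1)"
    by (simp add: qpoch_def)
  also have "\<dots> \<le> (\<Prod>j<n. 1 + norm (- (a * q ^ j))) - 1"
    by (rule norm_prod_minus1_le_prod_minus1)
  also have "(\<Prod>j<n. 1 + norm (- (a * q ^ j))) \<le> (\<Prod>j<n. exp (norm a * norm q ^ j))"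
    by (intro prod_mono) (auto simp: norm_mult norm_power)
  also have "\<dots> = exp (norm a * (\<Sum>j<n. norm q ^ j))"
    by (simp add: exp_sum sum_distrib_left)
  also have "\<dots> \<le> exp (norm a * (1 / (1 - norm q)))"
    using assms by (intro iffD2[OF exp_le_cancel_iff] mult_left_mono sum_geometric_le) auto
  finally show ?thesis by simp
qed

lemma norm_qpoch_le:
  assumes "norm q < 1" "norm a \<le> s"
  shows "norm (qpoch a q n) \<le> exp (s / (1 - norm q))"
proof -
  have "norm (qpoch a q n) \<le> norm (qpoch a q n - 1) + 1"
    using norm_triangle_ineq[of "qpoch a q n - 1" 1] by simp
  also have "\<dots> \<le> exp (norm a / (1 - norm q))"
    using norm_qpoch_minus_1_le[OF assms(1), of a n] by simp
  also have "\<dots> \<le> exp (s / (1 - norm q))"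
    using assms by (simp add: divide_right_mono)
  finally show ?thesis .
qed

lemma norm_mult_power_less_1:
  fixes a q :: complex
  assumes "norm a < 1" "norm q < 1"
  shows "norm (a * q ^ n) < 1"
proof -
  have "norm (a * q ^ n) \<le> norm a * 1"
    unfolding norm_mult norm_power using assms by (intro mult_left_mono power_le_one) auto
  with assms show ?thesis by simp
qed

lemma qpoch_nonzero:
  assumes "norm a < 1" "norm q < 1"
  shows "qpoch a q n \<noteq> 0"
proof -
  have "a * q ^ j \<noteq> 1" for j
    using norm_mult_power_less_1[OF assms, of j] by auto
  then show ?thesis by (simp add: qpoch_def)
qed

text \<open>With \<open>u = s * norm q ^ j\<close>, each inverse factor is at most
  \<open>1 / (1 - u) = 1 + u / (1 - u)\<close>, hence at most \<open>exp (u / (1 - s))\<close>; the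
  exponents sum geometrically. Uniformity in \<open>a\<close> on the disc of radius \<open>s\<close>
  serves the later limits.\<close>

lemma norm_inverse_qpoch_le:
  assumes "norm q < 1" "norm a \<le> s" "s < 1"
  shows "norm (1 / qpoch a q n) \<le> exp (s / (1 - s) / (1 - norm q))"
proof -
  have s: "0 \<le> s" using assms norm_ge_zero[of a] by linarith
  have "norm (1 / (1 - a * q ^ j)) \<le> exp (s / (1 - s) * norm q ^ j)" for j
  proof -
    define u where "u = s * norm q ^ j"
    have "u \<le> s * 1"
      unfolding u_def using assms s by (intro mult_left_mono power_le_one) auto
    then have u: "0 \<le> u" "u \<le> s" "u < 1" using assms s by (auto simp: u_def)
    have "norm (a * q ^ j) \<le> u"
      unfolding norm_mult norm_power u_def using assms by (intro mult_right_mono) auto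
    then have "1 - u \<le> norm (1 - a * q ^ j)"
      using norm_triangle_ineq2[of 1 "a * q ^ j"] by simp
    then have "norm (1 / (1 - a * q ^ j)) \<le> 1 / (1 - u)"
      using u by (simp add: norm_divide frac_le)
    also have "\<dots> = 1 + u / (1 - u)" using u by (simp add: field_simps)
    also have "\<dots> \<le> 1 + u / (1 - s)" using u assms by (intro add_left_mono frac_le) auto
    also have "\<dots> \<le> exp (u / (1 - s))" by (rule exp_ge_add_one_self)
    finally show ?thesis by (simp add: u_def)
  qed
  then have "norm (1 / qpoch a q n) \<le> (\<Prod>j<n. exp (s / (1 - s) * norm q ^ j))"
    unfolding qpoch_def prod_dividef[of "\<lambda>_. 1", simplified, symmetric] prod_norm[symmetric]
    by (intro prod_mono) auto
  also have "\<dots> = exp (s / (1 - s) * (\<Sum>j<n. norm q ^ j))"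
    by (simp add: exp_sum sum_distrib_left)
  also have "\<dots> \<le> exp (s / (1 - s) * (1 / (1 - norm q)))"
    using assms s by (intro iffD2[OF exp_le_cancel_iff] mult_left_mono sum_geometric_le) auto
  finally show ?thesis by simp
qed

section \<open>Infinite products: convergence, shift, nonvanishing\<close>

lemma qpoch_LIMSEQ:
  assumes "norm q < 1"
  shows "qpoch a q \<longlonglongrightarrow> qpoch_inf a q"
proof -
  have "abs_convergent_prod (\<lambda>j. 1 - a * q ^ j)"
    unfolding abs_convergent_prod_conv_summable
    using assms by (auto simp: norm_mult norm_power intro!: summable_mult summable_geometric)
  then have "convergent (\<lambda>n. \<Prod>j\<le>n. 1 - a * q ^ j)"
    by (intro convergent_prod_imp_convergent abs_convergent_prod_imp_convergent_prod)
  then have "convergent (\<lambda>n. qpoch a q (Suc n))"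
    by (simp add: qpoch_def lessThan_Suc_atMost)
  then have "convergent (qpoch a q)"
    by (subst (asm) convergent_Suc_iff)
  then show ?thesis
    unfolding qpoch_inf_def convergent_LIMSEQ_iff .
qed

lemma qpoch_inf_shift:
  assumes "norm q < 1"
  shows "qpoch_inf a q = (1 - a) * qpoch_inf (a * q) q"
proof (rule LIMSEQ_unique)
  show "(\<lambda>n. qpoch a q (Suc n)) \<longlonglongrightarrow> qpoch_inf a q"
    using LIMSEQ_Suc[OF qpoch_LIMSEQ[OF assms]] .
  show "(\<lambda>n. qpoch a q (Suc n)) \<longlonglongrightarrow> (1 - a) * qpoch_inf (a * q) q"
    unfolding qpoch_Suc_shift by (intro tendsto_intros qpoch_LIMSEQ assms)
qed

lemma norm_qpoch_inf_le:
  assumes "norm q < 1" "norm a \<le> s"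
  shows "norm (qpoch_inf a q) \<le> exp (s / (1 - norm q))"
  by (rule LIMSEQ_le_const2[OF tendsto_norm[OF qpoch_LIMSEQ[OF assms(1)]]])
    (use norm_qpoch_le[OF assms] in auto)

lemma norm_qpoch_inf_minus_1_le:
  assumes "norm q < 1"
  shows "norm (qpoch_inf a q - 1) \<le> exp (norm a / (1 - norm q)) - 1"
  by (rule LIMSEQ_le_const2[OF tendsto_norm[OF tendsto_diff[OF qpoch_LIMSEQ[OF assms] tendsto_const]]])
    (use norm_qpoch_minus_1_le[OF assms] in auto)

text \<open>The inverses of the partial products are bounded by \<open>C\<close>, so the partial
  products stay at distance at least \<open>1 / C\<close> from 0.\<close>

lemma qpoch_inf_nonzero:
  assumes "norm a < 1" "norm q < 1"
  shows "qpoch_inf a q \<noteq> 0"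
proof
  assume "qpoch_inf a q = 0"
  define C where "C = exp (norm a / (1 - norm a) / (1 - norm q))"
  have "1 \<le> C * norm (qpoch a q n)" for n
    using norm_inverse_qpoch_le[OF assms(2) order.refl assms(1), of n] qpoch_nonzero[OF assms, of n]
    by (simp add: C_def norm_divide field_simps)
  moreover have "(\<lambda>n. C * norm (qpoch a q n)) \<longlonglongrightarrow> C * norm (qpoch_inf a q)"
    by (intro tendsto_intros qpoch_LIMSEQ assms)
  ultimately have "1 \<le> C * norm (qpoch_inf a q)"
    by (intro LIMSEQ_le_const) auto
  with \<open>qpoch_inf a q = 0\<close> show False by simp
qed

section \<open>Splitting identities and Euler's product identity\<close>

lemma qpoch_even_odd: "qpoch a q (2 * n) = qpoch a (q\<^sup>2) n * qpoch (a * q) (q\<^sup>2) n"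
proof (induction n)
  case (Suc n)
  have "qpoch a q (2 * Suc n) = qpoch a q (2 * n) * (1 - a * q ^ (2 * n)) * (1 - a * q ^ Suc (2 * n))"
    by (simp add: qpoch_Suc)
  also have "q ^ (2 * n) = (q\<^sup>2) ^ n" by (rule power_mult)
  also have "q ^ Suc (2 * n) = q * (q\<^sup>2) ^ n" by (simp add: power_mult)
  finally show ?case unfolding Suc.IH by (simp add: qpoch_Suc mult_ac)
qed simp

lemma qpoch_uminus: "qpoch a q n * qpoch (- a) q n = qpoch (a\<^sup>2) (q\<^sup>2) n"
proof (induction n)
  case (Suc n)
  have "(1 - a * q ^ n) * (1 - - a * q ^ n) = 1 - a\<^sup>2 * (q\<^sup>2) ^ n"
    by (simp add: power2_eq_square power_mult_distrib algebra_simps)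
  with Suc show ?case by (simp only: qpoch_Suc mult_ac) (simp only: flip: mult.assoc)
qed simp

text \<open>The finite form of the product is \<open>qpoch q q (2 * n) / qpoch q q n\<close>, whose
  numerator and denominator share the nonzero limit \<open>qpoch_inf q q\<close>.\<close>

lemma qpoch_inf_euler:
  assumes "norm q < 1"
  shows "qpoch_inf q (q\<^sup>2) * qpoch_inf (- q) q = 1"
proof (rule LIMSEQ_unique)
  have q2: "norm (q\<^sup>2) < 1" using assms by (simp add: norm_power power_less_one_iff)
  show "(\<lambda>n. qpoch q (q\<^sup>2) n * qpoch (- q) q n) \<longlonglongrightarrow> qpoch_inf q (q\<^sup>2) * qpoch_inf (- q) q"
    by (intro tendsto_intros qpoch_LIMSEQ assms q2)
  have "qpoch q (q\<^sup>2) n * qpoch (- q) q n = qpoch q q (2 * n) / qpoch q q n" for n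
    using qpoch_uminus[of q q n] qpoch_even_odd[of q q n] qpoch_nonzero[OF assms assms, of n]
    by (simp add: power2_eq_square field_simps)
  moreover have "(\<lambda>n. qpoch q q (2 * n) / qpoch q q n) \<longlonglongrightarrow> qpoch_inf q q / qpoch_inf q q"
    using LIMSEQ_subseq_LIMSEQ[OF qpoch_LIMSEQ[OF assms, of q], of "\<lambda>n. 2 * n"]
    by (intro tendsto_divide qpoch_LIMSEQ qpoch_inf_nonzero assms) (auto simp: strict_mono_def o_def)
  ultimately show "(\<lambda>n. qpoch q (q\<^sup>2) n * qpoch (- q) q n) \<longlonglongrightarrow> 1"
    using qpoch_inf_nonzero[OF assms assms] by simp
qed

subsection \<open>The series expansion of nu and its functional equations\<close>

definition nu_gen :: "complex \<Rightarrow> complex \<Rightarrow> complex \<Rightarrow> complex" where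
  "nu_gen z x q = (\<Sum>n. z ^ n * q ^ (Suc n choose 2) / qpoch x q (Suc n))"

lemma le_choose_two: "n \<le> Suc n choose 2"
  by (simp add: numeral_2_eq_2)

lemma choose_two_Suc: "Suc (Suc n) choose 2 = (Suc n choose 2) + Suc n"
  by (simp add: numeral_2_eq_2)

lemma double_choose_two: "2 * (Suc n choose 2) = n\<^sup>2 + n"
  by (induction n) (simp_all add: choose_two_Suc power2_eq_square)

lemma norm_power_choose_two_le:
  fixes q :: complex
  assumes "norm q < 1"
  shows "norm (q ^ (Suc n choose 2)) \<le> norm q ^ n"
  unfolding norm_power using assms by (intro power_decreasing le_choose_two) auto

text \<open>A geometric majorant whose constant depends on \<open>x\<close> only through
  \<open>s\<close>, as Tannery's theorem requires when \<open>x\<close> moves.\<close>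

lemma norm_nu_gen_term_le:
  assumes "norm z \<le> 1" "norm x \<le> s" "s < 1" "norm q < 1"
  shows "norm (z ^ n * q ^ (Suc n choose 2) / qpoch x q (Suc n))
           \<le> exp (s / (1 - s) / (1 - norm q)) * norm q ^ n"
proof -
  have "norm (z ^ n * q ^ (Suc n choose 2) / qpoch x q (Suc n))
      = norm (1 / qpoch x q (Suc n)) * (norm z ^ n * norm (q ^ (Suc n choose 2)))"
    by (simp add: norm_mult norm_divide norm_power)
  also have "\<dots> \<le> exp (s / (1 - s) / (1 - norm q)) * (1 * norm q ^ n)"
    using assms
    by (intro mult_mono norm_inverse_qpoch_le norm_power_choose_two_le power_le_one) auto
  finally show ?thesis by simp
qed

lemma nu_gen_sums:
  assumes "norm z \<le> 1" "norm x < 1" "norm q < 1"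
  shows "(\<lambda>n. z ^ n * q ^ (Suc n choose 2) / qpoch x q (Suc n)) sums nu_gen z x q"
  unfolding nu_gen_def
  using assms norm_nu_gen_term_le[OF assms(1) order.refl assms(2,3)]
  by (intro summable_sums summable_comparison_test'[OF summable_mult[OF summable_geometric]]) auto

lemma norm_nu_gen_le:
  assumes "norm z \<le> 1" "norm x < 1" "norm q < 1"
  shows "norm (nu_gen z x q) \<le> exp (norm x / (1 - norm x) / (1 - norm q)) / (1 - norm q)"
proof -
  have "norm (nu_gen z x q) \<le> (\<Sum>n. exp (norm x / (1 - norm x) / (1 - norm q)) * norm q ^ n)"
    unfolding nu_gen_def using assms
    by (intro norm_suminf_le norm_nu_gen_term_le summable_mult summable_geometric) auto
  then show ?thesis
    using assms by (simp add: suminf_mult suminf_geometric summable_geometric)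
qed

text \<open>Since \<open>b n = q ^ n * a n\<close>, the combination
  \<open>a (Suc n) - x * b (Suc n)\<close> carries the factor \<open>1 - x * q ^ Suc n\<close>. It
  cancels the last factor of the denominator and leaves \<open>z * q * b n\<close>.\<close>

lemma nu_gen_shift_first:
  assumes "norm z \<le> 1" "norm x < 1" "norm q < 1"
  shows "nu_gen z x q = 1 + (x + z * q) * nu_gen (z * q) x q"
proof -
  define a where "a n = z ^ n * q ^ (Suc n choose 2) / qpoch x q (Suc n)" for n
  define b where "b n = (z * q) ^ n * q ^ (Suc n choose 2) / qpoch x q (Suc n)" for n
  have zq: "norm (z * q) \<le> 1"
    using mult_mono[of "norm z" 1 "norm q" 1] assms by (simp add: norm_mult)
  have a: "a sums nu_gen z x q" and b: "b sums nu_gen (z * q) x q"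
    unfolding a_def b_def using assms zq by (simp_all only: nu_gen_sums)
  have nz: "qpoch x q n \<noteq> 0" for n
    using assms by (intro qpoch_nonzero) auto
  have "z * q * b n = a (Suc n) - x * b (Suc n)" for n
  proof -
    have "a (Suc n) - x * b (Suc n)
        = z ^ Suc n * q ^ (Suc (Suc n) choose 2) * (1 - x * q ^ Suc n) / qpoch x q (Suc (Suc n))"
      by (simp add: a_def b_def power_mult_distrib algebra_simps flip: diff_divide_distrib)
    also have "\<dots> = z ^ Suc n * q ^ (Suc (Suc n) choose 2) / qpoch x q (Suc n)"
      using nz[of "Suc (Suc n)"] unfolding qpoch_Suc[of x q "Suc n"] by simp
    also have "\<dots> = z * q * b n"
      unfolding b_def choose_two_Suc by (simp add: power_add power_mult_distrib)
    finally show ?thesis ..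
  qed
  moreover have "(\<lambda>n. z * q * b n) sums (z * q * nu_gen (z * q) x q)"
    by (rule sums_mult[OF b])
  ultimately have "(\<lambda>n. a (Suc n) - x * b (Suc n)) sums (z * q * nu_gen (z * q) x q)"
    by simp
  then have "(\<lambda>n. a n - x * b n) sums (z * q * nu_gen (z * q) x q + (a 0 - x * b 0))"
    by (simp only: sums_Suc_iff[of "\<lambda>n. a n - x * b n"])
  moreover have "(\<lambda>n. a n - x * b n) sums (nu_gen z x q - x * nu_gen (z * q) x q)"
    by (intro sums_diff sums_mult a b)
  \<comment> \<open>Both zeroth terms are \<open>1 / (1 - x)\<close>, because
    \<open>Suc 0 choose 2\<close> is 0.\<close>
  moreover have "a 0 - x * b 0 = 1"
    using nz[of 1] by (simp add: a_def b_def qpoch_Suc field_simps numeral_2_eq_2)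
  ultimately have "nu_gen z x q - x * nu_gen (z * q) x q = z * q * nu_gen (z * q) x q + 1"
    using sums_unique2 by metis
  then show ?thesis by (simp add: algebra_simps)
qed

text \<open>The denominator of \<open>b n\<close> is that of \<open>a (Suc n)\<close> divided by
  \<open>1 - x\<close>, which makes \<open>b n\<close> a combination of two consecutive
  \<open>a\<close> terms. Summation loses only \<open>a 0 = 1 / (1 - x)\<close>, the source of the
  summand \<open>x\<close>.\<close>

lemma nu_gen_shift_second:
  assumes "norm x < 1" "norm q < 1"
  shows "(1 - x\<^sup>2) * nu_gen 1 x q = nu_gen 1 (x * q) q + x"
proof -
  define a where "a n = q ^ (Suc n choose 2) / qpoch x q (Suc n)" for n
  define b where "b n = q ^ (Suc n choose 2) / qpoch (x * q) q (Suc n)" for n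
  have xq: "norm (x * q) < 1"
    using norm_mult_power_less_1[OF assms, of 1] by simp
  have a: "a sums nu_gen 1 x q" and b: "b sums nu_gen 1 (x * q) q"
    unfolding a_def b_def using nu_gen_sums[of 1 x q] nu_gen_sums[of 1 "x * q" q] assms xq by simp_all
  have nz: "qpoch x q n \<noteq> 0" for n
    using assms by (intro qpoch_nonzero) auto
  have x1: "x \<noteq> 1" using assms by auto
  have b_eq: "b n = (1 - x) * (a n + x * a (Suc n))" for n
  proof -
    define y where "y = x * q ^ Suc n"
    have P: "qpoch x q (Suc (Suc n)) = qpoch x q (Suc n) * (1 - y)"
      by (simp only: qpoch_Suc y_def)
    then have y1: "1 - y \<noteq> 0" using nz[of "Suc (Suc n)"] by auto
    have Q: "qpoch (x * q) q (Suc n) = qpoch x q (Suc n) * (1 - y) / (1 - x)"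
      using qpoch_Suc_shift[of x q "Suc n"] x1 unfolding P by (simp add: field_simps)
    have "x * a (Suc n) = q ^ (Suc n choose 2) * y / (qpoch x q (Suc n) * (1 - y))"
      unfolding a_def P choose_two_Suc y_def by (simp add: power_add)
    moreover have "a n = q ^ (Suc n choose 2) * (1 - y) / (qpoch x q (Suc n) * (1 - y))"
      unfolding a_def using y1 by simp
    ultimately have "a n + x * a (Suc n) = q ^ (Suc n choose 2) / (qpoch x q (Suc n) * (1 - y))"
      by (simp only: flip: add_divide_distrib) (simp add: algebra_simps)
    then show ?thesis unfolding b_def Q by simp
  qed
  have "(\<lambda>n. a (Suc n)) sums (nu_gen 1 x q - a 0)"
    using a by (simp add: sums_Suc_iff)
  then have "b sums ((1 - x) * (nu_gen 1 x q + x * (nu_gen 1 x q - a 0)))"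
    unfolding b_eq by (intro sums_mult sums_add a)
  with b have "nu_gen 1 (x * q) q = (1 - x) * (nu_gen 1 x q + x * (nu_gen 1 x q - a 0))"
    by (rule sums_unique2)
  moreover have "(1 - x) * a 0 = 1"
    using x1 by (simp add: a_def qpoch_Suc numeral_2_eq_2)
  ultimately show ?thesis
    by algebra
qed

text \<open>Tannery's theorem: each denominator tends to 1, and
  \<open>norm (x * q ^ k) \<le> norm x\<close> gives one majorant for all \<open>k\<close>.\<close>

lemma nu_gen_tendsto_psi:
  assumes "norm x < 1" "norm q < 1"
  shows "(\<lambda>k. nu_gen 1 (x * q ^ k) q) \<longlonglongrightarrow> psi q"
proof -
  define M where "M n = exp (norm x / (1 - norm x) / (1 - norm q)) * norm q ^ n" for n
  define a where "a n k = q ^ (Suc n choose 2) / qpoch (x * q ^ k) q (Suc n)" for n k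
  have "(\<lambda>k. q ^ k) \<longlonglongrightarrow> 0"
    using assms by (intro LIMSEQ_power_zero)
  then have lim: "(\<lambda>k. x * q ^ k) \<longlonglongrightarrow> 0"
    using tendsto_mult_right_zero by blast
  have "a n \<longlonglongrightarrow> q ^ (Suc n choose 2)" for n
  proof -
    have "(\<lambda>k. qpoch (x * q ^ k) q (Suc n)) \<longlonglongrightarrow> (\<Prod>j<Suc n. 1 - 0 * q ^ j)"
      unfolding qpoch_def by (intro tendsto_intros lim)
    then show ?thesis
      unfolding a_def using tendsto_divide[OF tendsto_const] by fastforce
  qed
  moreover have "norm (a n k) \<le> M n" for n k
  proof -
    have "norm (x * q ^ k) \<le> norm x * 1"
      unfolding norm_mult norm_power using assms by (intro mult_left_mono power_le_one) auto
    then show ?thesis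
      using norm_nu_gen_term_le[of 1 "x * q ^ k" "norm x" q n] assms by (simp add: a_def M_def)
  qed
  moreover have "summable M"
    unfolding M_def using assms by (intro summable_mult summable_geometric) auto
  ultimately have "(\<lambda>k. \<Sum>n. a n k) \<longlonglongrightarrow> (\<Sum>n. q ^ (Suc n choose 2))"
    using tannerys_theorem[of a "\<lambda>n. q ^ (Suc n choose 2)" sequentially M]
    by (simp add: case_prod_unfold)
  then show ?thesis
    by (simp add: a_def nu_gen_def psi_def)
qed

text \<open>The factor \<open>1 - (x * q ^ n)\<^sup>2\<close> of the second functional equation is
  the next factor of \<open>qpoch (x\<^sup>2) (q\<^sup>2)\<close>, so iteration gives partial sums
  with an explicit remainder. That remainder does not vanish in the limit: it becomes the
  \<open>psi\<close> term.\<close>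

lemma nu_gen_expansion:
  assumes "norm x < 1" "norm q < 1"
  shows "(\<lambda>k. x * (q ^ k / qpoch (x\<^sup>2) (q\<^sup>2) (Suc k)))
           sums (nu_gen 1 x q - psi q / qpoch_inf (x\<^sup>2) (q\<^sup>2))"
proof -
  have x2: "norm (x\<^sup>2) < 1" and q2: "norm (q\<^sup>2) < 1"
    using assms by (simp_all add: norm_power power_less_one_iff)
  have nz: "qpoch (x\<^sup>2) (q\<^sup>2) k \<noteq> 0" for k
    using x2 q2 by (rule qpoch_nonzero)
  have "(\<Sum>k<n. x * (q ^ k / qpoch (x\<^sup>2) (q\<^sup>2) (Suc k)))
      = nu_gen 1 x q - nu_gen 1 (x * q ^ n) q / qpoch (x\<^sup>2) (q\<^sup>2) n" for n
  proof (induction n)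
    case (Suc n)
    have "(1 - x\<^sup>2 * (q\<^sup>2) ^ n) * nu_gen 1 (x * q ^ n) q = nu_gen 1 (x * q ^ Suc n) q + x * q ^ n"
      using nu_gen_shift_second[OF norm_mult_power_less_1[OF assms, of n] assms(2)]
      by (simp add: power_mult_distrib mult_ac flip: power_mult)
    moreover have "qpoch (x\<^sup>2) (q\<^sup>2) (Suc n) = qpoch (x\<^sup>2) (q\<^sup>2) n * (1 - x\<^sup>2 * (q\<^sup>2) ^ n)"
      by (rule qpoch_Suc)
    ultimately have "nu_gen 1 (x * q ^ n) q / qpoch (x\<^sup>2) (q\<^sup>2) n
        = (nu_gen 1 (x * q ^ Suc n) q + x * q ^ n) / qpoch (x\<^sup>2) (q\<^sup>2) (Suc n)"
      using nz[of n] nz[of "Suc n"] by (simp add: frac_eq_eq mult_ac)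
    then show ?case
      using Suc by (simp add: add_divide_distrib)
  qed simp
  moreover have "(\<lambda>n. nu_gen 1 x q - nu_gen 1 (x * q ^ n) q / qpoch (x\<^sup>2) (q\<^sup>2) n)
      \<longlonglongrightarrow> nu_gen 1 x q - psi q / qpoch_inf (x\<^sup>2) (q\<^sup>2)"
    by (intro tendsto_intros nu_gen_tendsto_psi qpoch_LIMSEQ qpoch_inf_nonzero assms x2 q2)
  ultimately show ?thesis
    unfolding sums_def by simp
qed

subsection \<open>A symmetric expansion and omega\<close>

text \<open>Up to the factor \<open>1 - y\<close>, Fine's series \<open>F(a, b; t)\<close> in base
  \<open>p\<close> with \<open>a = 0\<close> and \<open>b = y\<close>.\<close>

definition omega_gen :: "complex \<Rightarrow> complex \<Rightarrow> complex \<Rightarrow> complex" where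
  "omega_gen t y p = (\<Sum>n. t ^ n / qpoch y p (Suc n))"

lemma norm_omega_gen_term_le:
  assumes "norm t \<le> r" "norm y \<le> s" "s < 1" "norm p < 1"
  shows "norm (t ^ n / qpoch y p (Suc n)) \<le> exp (s / (1 - s) / (1 - norm p)) * r ^ n"
proof -
  have "norm (t ^ n / qpoch y p (Suc n)) = norm (1 / qpoch y p (Suc n)) * norm t ^ n"
    by (simp add: norm_divide norm_power)
  also have "\<dots> \<le> exp (s / (1 - s) / (1 - norm p)) * r ^ n"
    using assms by (intro mult_mono norm_inverse_qpoch_le power_mono) auto
  finally show ?thesis .
qed

lemma omega_gen_sums:
  assumes "norm t < 1" "norm y < 1" "norm p < 1"
  shows "(\<lambda>n. t ^ n / qpoch y p (Suc n)) sums omega_gen t y p"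
  unfolding omega_gen_def
  using assms norm_omega_gen_term_le[OF order.refl order.refl assms(2,3)]
  by (intro summable_sums summable_comparison_test'[OF summable_mult[OF summable_geometric]]) auto

lemma norm_omega_gen_le:
  assumes "norm t \<le> r" "r < 1" "norm y \<le> s" "s < 1" "norm p < 1"
  shows "norm (omega_gen t y p) \<le> exp (s / (1 - s) / (1 - norm p)) / (1 - r)"
proof -
  have r: "0 \<le> r" using assms(1) norm_ge_zero[of t] by linarith
  have "norm (omega_gen t y p) \<le> (\<Sum>n. exp (s / (1 - s) / (1 - norm p)) * r ^ n)"
    unfolding omega_gen_def using assms r
    by (intro norm_suminf_le norm_omega_gen_term_le summable_mult summable_geometric) auto
  then show ?thesis
    using assms r by (simp add: suminf_mult suminf_geometric summable_geometric)
qed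

text \<open>Over the common denominator \<open>qpoch y p (Suc (Suc n))\<close>, the numerator of
  \<open>a (Suc n) - t * a n\<close> is \<open>t ^ Suc n * w\<close>, a multiple of the term
  \<open>b n\<close>. Both parameters are scaled by \<open>p\<close> at once, so the equation can be
  iterated symmetrically.\<close>

lemma omega_gen_shift:
  assumes "norm t < 1" "norm y < 1" "norm p < 1"
  shows "(1 - t) * (1 - y) * omega_gen t y p = 1 + t * y * p * omega_gen (t * p) (y * p) p"
proof -
  define a where "a n = t ^ n / qpoch y p (Suc n)" for n
  define b where "b n = (t * p) ^ n / qpoch (y * p) p (Suc n)" for n
  have tp: "norm (t * p) < 1" and yp: "norm (y * p) < 1"
    using norm_mult_power_less_1[of _ p 1] assms by simp_all
  have a: "a sums omega_gen t y p" and b: "b sums omega_gen (t * p) (y * p) p"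
    unfolding a_def b_def using omega_gen_sums assms tp yp by simp_all
  have nz: "qpoch y p n \<noteq> 0" for n
    using assms by (intro qpoch_nonzero) auto
  have y1: "y \<noteq> 1" using assms by auto
  have b_eq: "t * y * p * b n = (1 - y) * (a (Suc n) - t * a n)" for n
  proof -
    define w where "w = y * p ^ Suc n"
    have P: "qpoch y p (Suc (Suc n)) = qpoch y p (Suc n) * (1 - w)"
      by (simp only: qpoch_Suc w_def)
    then have w1: "1 - w \<noteq> 0" using nz[of "Suc (Suc n)"] by auto
    have Q: "qpoch (y * p) p (Suc n) = qpoch y p (Suc n) * (1 - w) / (1 - y)"
      using qpoch_Suc_shift[of y p "Suc n"] y1 unfolding P by (simp add: field_simps)
    have "t * a n = t ^ Suc n * (1 - w) / (qpoch y p (Suc n) * (1 - w))"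
      unfolding a_def using w1 by simp
    then have "a (Suc n) - t * a n = t ^ Suc n * w / (qpoch y p (Suc n) * (1 - w))"
      unfolding a_def P by (simp only: flip: diff_divide_distrib) (simp add: algebra_simps)
    then show ?thesis unfolding b_def Q by (simp add: w_def power_mult_distrib)
  qed
  have "(\<lambda>n. a (Suc n)) sums (omega_gen t y p - a 0)"
    using a by (simp add: sums_Suc_iff)
  then have "(\<lambda>n. t * y * p * b n) sums ((1 - y) * ((omega_gen t y p - a 0) - t * omega_gen t y p))"
    unfolding b_eq by (intro sums_mult sums_diff a)
  moreover have "(\<lambda>n. t * y * p * b n) sums (t * y * p * omega_gen (t * p) (y * p) p)"
    by (rule sums_mult[OF b])
  ultimately have "t * y * p * omega_gen (t * p) (y * p) p
      = (1 - y) * ((omega_gen t y p - a 0) - t * omega_gen t y p)"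
    by (rule sums_unique2[rotated])
  moreover have "(1 - y) * a 0 = 1"
    using y1 by (simp add: a_def qpoch_Suc)
  ultimately show ?thesis by algebra
qed

text \<open>The Rogers-Fine identity with one parameter zero, obtained by iterating
  \<open>omega_gen_shift\<close>.\<close>

lemma omega_gen_expansion:
  assumes "norm t < 1" "norm y < 1" "norm p < 1"
  shows "(\<lambda>n. (t * y) ^ n * p ^ n\<^sup>2 / (qpoch t p (Suc n) * qpoch y p (Suc n))) sums omega_gen t y p"
proof -
  \<comment> \<open>\<open>R n\<close> is the remainder after \<open>n\<close> iterations.\<close>
  define R where "R n = (t * y) ^ n * p ^ n\<^sup>2 * (1 / qpoch t p n) * (1 / qpoch y p n)
    * omega_gen (t * p ^ n) (y * p ^ n) p" for n
  have nz: "qpoch t p n \<noteq> 0" "qpoch y p n \<noteq> 0" for n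
    using assms by (simp_all add: qpoch_nonzero)
  have "(\<Sum>k<n. (t * y) ^ k * p ^ k\<^sup>2 / (qpoch t p (Suc k) * qpoch y p (Suc k)))
      = omega_gen t y p - R n" for n
  proof (induction n)
    case (Suc n)
    define T Y where "T = t * p ^ n" and "Y = y * p ^ n"
    have "(1 - T) * (1 - Y) * omega_gen T Y p = 1 + T * Y * p * omega_gen (T * p) (Y * p) p"
      unfolding T_def Y_def by (intro omega_gen_shift norm_mult_power_less_1 assms)
    moreover have 1: "qpoch t p (Suc n) = qpoch t p n * (1 - T)" "qpoch y p (Suc n) = qpoch y p n * (1 - Y)"
      by (simp_all add: qpoch_Suc T_def Y_def)
    moreover from this have "1 - T \<noteq> 0" "1 - Y \<noteq> 0"
      using nz[of "Suc n"] by auto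
    ultimately have "omega_gen T Y p = (1 + T * Y * p * omega_gen (T * p) (Y * p) p) / ((1 - T) * (1 - Y))"
      by (simp add: nonzero_eq_divide_eq mult_ac)
    then have "R n = (t * y) ^ n * p ^ n\<^sup>2 / (qpoch t p (Suc n) * qpoch y p (Suc n))
        + (t * y) ^ n * p ^ n\<^sup>2 * (T * Y * p) * omega_gen (T * p) (Y * p) p
          / (qpoch t p (Suc n) * qpoch y p (Suc n))"
      unfolding R_def 1 by (simp add: add_divide_distrib distrib_left mult_ac flip: T_def Y_def)
    \<comment> \<open>\<open>T * Y * p\<close> contributes \<open>p ^ (2 * n + 1)\<close>; summing
      odd numbers produces the square exponent.\<close>
    moreover have "(t * y) ^ n * p ^ n\<^sup>2 * (T * Y * p) = (t * y) ^ Suc n * p ^ (Suc n)\<^sup>2"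
      by (simp add: T_def Y_def power2_eq_square power_add mult_ac)
    moreover have "R (Suc n) = (t * y) ^ Suc n * p ^ (Suc n)\<^sup>2 * omega_gen (T * p) (Y * p) p
          / (qpoch t p (Suc n) * qpoch y p (Suc n))"
    proof -
      have "t * p ^ Suc n = T * p" "y * p ^ Suc n = Y * p"
        by (simp_all add: T_def Y_def)
      then show ?thesis unfolding R_def by (simp del: power_Suc)
    qed
    ultimately have "R n = (t * y) ^ n * p ^ n\<^sup>2 / (qpoch t p (Suc n) * qpoch y p (Suc n)) + R (Suc n)"
      by (simp only:)
    then show ?case using Suc by simp
  qed (simp add: R_def)
  moreover have "R \<longlonglongrightarrow> 0"
  proof (rule Lim_null_comparison)
    define Ct where "Ct = exp (norm t / (1 - norm t) / (1 - norm p))"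
    define Cy where "Cy = exp (norm y / (1 - norm y) / (1 - norm p))"
    have small: "norm (x * p ^ n) \<le> norm x" for x n
    proof -
      have "norm (x * p ^ n) \<le> norm x * 1"
        unfolding norm_mult norm_power using assms by (intro mult_left_mono power_le_one) auto
      then show ?thesis by simp
    qed
    \<comment> \<open>The power of \<open>p\<close> is merely bounded by 1; the decay comes from
      \<open>(t * y) ^ n\<close>.\<close>
    have "norm (R n) \<le> norm (t * y) ^ n * 1 * Ct * Cy * (Cy / (1 - norm t))" for n
      unfolding R_def norm_mult[of _ "omega_gen _ _ _"] norm_mult[of _ "1 / _"]
        norm_mult[of _ "p ^ _"] norm_power Ct_def Cy_def using assms
      by (intro mult_mono norm_inverse_qpoch_le norm_omega_gen_le small power_le_one
            mult_nonneg_nonneg) auto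
    then show "\<forall>\<^sub>F n in sequentially. norm (R n) \<le> norm (t * y) ^ n * 1 * Ct * Cy * (Cy / (1 - norm t))"
      by simp
    have "norm (t * y) < 1"
      using mult_strict_mono'[of "norm t" 1 "norm y" 1] assms by (simp add: norm_mult)
    then have "(\<lambda>n. norm (t * y) ^ n) \<longlonglongrightarrow> 0"
      by (intro LIMSEQ_power_zero) simp
    then show "(\<lambda>n. norm (t * y) ^ n * 1 * Ct * Cy * (Cy / (1 - norm t))) \<longlonglongrightarrow> 0"
      by (intro tendsto_mult_left_zero) simp
  qed
  ultimately show ?thesis
    unfolding sums_def using tendsto_diff[OF tendsto_const[of "omega_gen t y p"]] by fastforce
qed

section \<open>Specialization to \<open>omega\<close> and \<open>nu\<close>, and the second
  equality\<close>

lemma omega_eq: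
  assumes "norm q < 1"
  shows "omega q = omega_gen q q (q\<^sup>2)"
proof -
  have "(q * q) ^ n * (q\<^sup>2) ^ n\<^sup>2 = q ^ (2 * n\<^sup>2 + 2 * n)" for n
    by (simp add: power_add power_mult flip: power2_eq_square)
  moreover have "norm (q\<^sup>2) < 1"
    using assms by (simp add: norm_power power_less_one_iff)
  ultimately show ?thesis
    using sums_unique[OF omega_gen_expansion[of q q "q\<^sup>2"]] assms
    by (simp add: omega_def power2_eq_square)
qed

text \<open>The exponent \<open>n\<^sup>2 + n\<close> is twice \<open>Suc n choose 2\<close>, so the
  sign of \<open>q\<close> disappears from the numerators.\<close>

lemma nu_uminus: "nu (- q) = nu_gen 1 q (q\<^sup>2)"
  unfolding nu_def nu_gen_def by (simp add: power_mult flip: double_choose_two)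

lemma nu_eq:
  assumes "norm q < 1"
  shows "nu (- q) = q * omega (q\<^sup>2) + qpoch_inf (- (q\<^sup>2)) (q\<^sup>2) * psi (q\<^sup>2)"
proof -
  have q2: "norm (q\<^sup>2) < 1" and q4: "norm ((q\<^sup>2)\<^sup>2) < 1"
    using assms by (simp_all add: norm_power power_less_one_iff)
  have "nu (- q) - psi (q\<^sup>2) / qpoch_inf (q\<^sup>2) ((q\<^sup>2)\<^sup>2) = q * omega (q\<^sup>2)"
    unfolding nu_uminus using nu_gen_expansion[OF assms q2] sums_mult[OF omega_gen_sums[OF q2 q2 q4], of q]
    unfolding omega_eq[OF q2] by (rule sums_unique2)
  moreover have "1 / qpoch_inf (q\<^sup>2) ((q\<^sup>2)\<^sup>2) = qpoch_inf (- (q\<^sup>2)) (q\<^sup>2)"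
    using qpoch_inf_euler[OF q2] by (metis mult_zero_left nonzero_eq_divide_eq mult.commute zero_neq_one)
  ultimately show ?thesis
    by (simp add: algebra_simps divide_inverse)
qed

subsection \<open>The series over distinct parts\<close>

definition distinct_term :: "complex \<Rightarrow> complex \<Rightarrow> nat \<Rightarrow> complex" where
  "distinct_term z q n =
     q ^ n * qpoch (- (z * q ^ (n + 1))) q n * qpoch_inf (- (z * q ^ (2 * n + 2))) (q\<^sup>2)"

lemma norm_distinct_term_le:
  assumes "norm z \<le> 1" "norm q < 1"
  shows "norm (distinct_term z q n)
           \<le> exp (1 / (1 - norm q)) * exp (1 / (1 - norm (q\<^sup>2))) * norm q ^ n"
proof -
  have q2: "norm (q\<^sup>2) < 1"
    using assms by (simp add: norm_power power_less_one_iff)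
  have small: "norm (- (z * q ^ m)) \<le> 1" for m
    unfolding norm_minus_cancel norm_mult norm_power
    using assms by (intro mult_le_one power_le_one) auto
  have "norm (distinct_term z q n) \<le> norm q ^ n * exp (1 / (1 - norm q)) * exp (1 / (1 - norm (q\<^sup>2)))"
    unfolding distinct_term_def norm_mult[of "_ * _" "qpoch_inf _ _"] norm_mult[of _ "qpoch _ _ _"]
      norm_power[of q n]
    using assms q2
    by (intro mult_mono norm_qpoch_le norm_qpoch_inf_le mult_nonneg_nonneg small) auto
  then show ?thesis by (simp add: mult_ac)
qed

lemma summable_distinct_term:
  assumes "norm z \<le> 1" "norm q < 1"
  shows "summable (distinct_term z q)"
  using assms norm_distinct_term_le[OF assms]
  by (intro summable_comparison_test'[OF summable_mult[OF summable_geometric]]) auto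

lemma norm_suminf_distinct_term_le:
  assumes "norm z \<le> 1" "norm q < 1"
  shows "norm (suminf (distinct_term z q))
           \<le> exp (1 / (1 - norm q)) * exp (1 / (1 - norm (q\<^sup>2))) / (1 - norm q)"
proof -
  have "norm (suminf (distinct_term z q))
      \<le> (\<Sum>n. exp (1 / (1 - norm q)) * exp (1 / (1 - norm (q\<^sup>2))) * norm q ^ n)"
    using assms by (intro norm_suminf_le norm_distinct_term_le summable_mult summable_geometric) auto
  then show ?thesis
    using assms by (simp add: suminf_mult suminf_geometric summable_geometric)
qed

text \<open>The finite product gains factors while its parameter tends to 0, so factorwise limits do
  not suffice; the bounds on the distance from 1, uniform in the length, do.\<close>

lemma distinct_telescope_tendsto_1:
  assumes "norm q < 1"
  shows "(\<lambda>n. qpoch (- (w * q ^ n)) q n * qpoch_inf (- (w * q ^ (2 * n))) (q\<^sup>2)) \<longlonglongrightarrow> 1"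
proof -
  have q2: "norm (q\<^sup>2) < 1"
    using assms by (simp add: norm_power power_less_one_iff)
  have lim: "(\<lambda>n. - (w * q ^ n)) \<longlonglongrightarrow> 0"
    using LIMSEQ_power_zero[OF assms] tendsto_minus[OF tendsto_mult_right_zero] by fastforce
  have lim2: "(\<lambda>n. - (w * q ^ (2 * n))) \<longlonglongrightarrow> 0"
    using LIMSEQ_subseq_LIMSEQ[OF lim, of "\<lambda>n. 2 * n"] by (simp add: strict_mono_def o_def)
  have bound: "(\<lambda>n. exp (norm (f n) / (1 - c)) - 1) \<longlonglongrightarrow> 0"
    if "f \<longlonglongrightarrow> 0" "c < 1" for f :: "nat \<Rightarrow> complex" and c :: real
  proof -
    have "(\<lambda>n. exp (norm (f n) / (1 - c)) - 1) \<longlonglongrightarrow> exp (norm (0 :: complex) / (1 - c)) - 1"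
      using that by (intro tendsto_intros) auto
    then show ?thesis by simp
  qed
  have "(\<lambda>n. qpoch (- (w * q ^ n)) q n - 1) \<longlonglongrightarrow> 0"
    using norm_qpoch_minus_1_le[OF assms]
    by (intro Lim_null_comparison[OF _ bound[OF lim assms]] always_eventually) blast
  moreover have "(\<lambda>n. qpoch_inf (- (w * q ^ (2 * n))) (q\<^sup>2) - 1) \<longlonglongrightarrow> 0"
    using norm_qpoch_inf_minus_1_le[OF q2]
    by (intro Lim_null_comparison[OF _ bound[OF lim2 q2]] always_eventually) blast
  ultimately show ?thesis
    using tendsto_mult[of _ 1 _ _ 1] unfolding LIM_zero_iff by fastforce
qed

lemma suminf_distinct_term_shift:
  assumes "norm z \<le> 1" "norm q < 1"
  shows "suminf (distinct_term z q) = 1 + (q + z * q\<^sup>2) * suminf (distinct_term (z * q\<^sup>2) q)"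
proof -
  define w where "w = z * q\<^sup>2"
  define U where "U n = qpoch (- (w * q ^ n)) q n * qpoch_inf (- (w * q ^ (2 * n))) (q\<^sup>2)" for n
  have q2: "norm (q\<^sup>2) < 1"
    using assms by (simp add: norm_power power_less_one_iff)
  have w: "norm w \<le> 1"
    using mult_mono[of "norm z" 1 "norm (q\<^sup>2)" 1] assms q2 by (simp add: w_def norm_mult)
  \<comment> \<open>All four quantities are multiples of \<open>A * B\<close>. What remains is
    \<open>q ^ Suc n * (1 + w * q ^ n) = (q + w) * q ^ n - (w * q ^ n - w * q ^ (2 * n +
    1))\<close>.\<close>
  have step: "distinct_term z q (Suc n) = (q + w) * distinct_term w q n - (U n - U (Suc n))" for n
  proof -
    define A where "A = qpoch (- (w * q ^ Suc n)) q n"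
    define B where "B = qpoch_inf (- (w * q ^ (2 * n + 2))) (q\<^sup>2)"
    have t: "distinct_term w q n = q ^ n * A * B"
      by (simp add: distinct_term_def A_def B_def)
    have "qpoch (- (z * q ^ (Suc n + 1))) q (Suc n) = (1 + w * q ^ n) * A"
      unfolding qpoch_Suc_shift by (simp add: A_def w_def power2_eq_square mult_ac)
    moreover have "qpoch_inf (- (z * q ^ (2 * Suc n + 2))) (q\<^sup>2) = B"
      by (simp add: B_def w_def power2_eq_square mult_ac)
    ultimately have t': "distinct_term z q (Suc n) = q ^ Suc n * ((1 + w * q ^ n) * A) * B"
      by (simp only: distinct_term_def)
    \<comment> \<open>The first factor of the infinite product, \<open>1 + w * q ^ (2 * n)\<close>,
      is exactly the one extending the finite product.\<close>
    have "U n = qpoch (- (w * q ^ n)) q (Suc n) * B"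
    proof -
      have "qpoch_inf (- (w * q ^ (2 * n))) (q\<^sup>2) = (1 + w * q ^ (2 * n)) * B"
        by (subst qpoch_inf_shift[OF q2]) (simp add: B_def power_add power2_eq_square mult_ac)
      then show ?thesis
        by (simp add: U_def qpoch_Suc mult_2 power_add)
    qed
    also have "qpoch (- (w * q ^ n)) q (Suc n) = (1 + w * q ^ n) * A"
      unfolding qpoch_Suc_shift by (simp add: A_def mult_ac)
    finally have U: "U n = (1 + w * q ^ n) * A * B" .
    have U': "U (Suc n) = A * (1 + w * q ^ (2 * n + 1)) * B"
    proof -
      have "w * q ^ Suc n * q ^ n = w * q ^ (2 * n + 1)"
        by (simp add: mult_2 power_add)
      then show ?thesis
        by (simp add: U_def A_def B_def qpoch_Suc)
    qed
    show ?thesis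
      unfolding t t' U U' by (simp add: algebra_simps mult_2_right power_add)
  qed
  have "(\<lambda>n. distinct_term z q (Suc n))
      sums ((q + w) * suminf (distinct_term w q) - (U 0 - 1))"
    unfolding step U_def
    by (intro sums_diff sums_mult telescope_sums' distinct_telescope_tendsto_1 assms
          summable_sums summable_distinct_term w)
  then have "distinct_term z q
      sums ((q + w) * suminf (distinct_term w q) - (U 0 - 1) + distinct_term z q 0)"
    by (simp only: sums_Suc_iff)
  \<comment> \<open>The telescoped boundary value \<open>U 0\<close> cancels against the initial
    term, leaving only the limit 1.\<close>
  moreover have "U 0 = distinct_term z q 0"
    by (simp add: U_def distinct_term_def w_def power2_eq_square)
  ultimately have "distinct_term z q sums (1 + (q + w) * suminf (distinct_term w q))"
    by (simp add: algebra_simps)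
  then show ?thesis
    unfolding w_def by (rule sums_unique[symmetric])
qed

text \<open>The difference \<open>h\<close> of the two solutions obeys the homogeneous equation.
  Iteration writes \<open>h 0\<close> as \<open>q ^ k\<close> times bounded quantities, which forces
  it to be 0.\<close>

lemma suminf_distinct_term_eq_nu_gen:
  assumes "norm q < 1"
  shows "suminf (distinct_term 1 q) = nu_gen 1 q (q\<^sup>2)"
proof -
  define h where "h k = suminf (distinct_term ((q\<^sup>2) ^ k) q) - nu_gen ((q\<^sup>2) ^ k) q (q\<^sup>2)" for k
  have q2: "norm (q\<^sup>2) < 1"
    using assms by (simp add: norm_power power_less_one_iff)
  have small: "norm ((q\<^sup>2) ^ k) \<le> 1" for k
    unfolding norm_power[of "q\<^sup>2"] using q2 by (intro power_le_one) auto
  have h_Suc: "h k = q * (1 + q * (q\<^sup>2) ^ k) * h (Suc k)" for k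
    using suminf_distinct_term_shift[OF small assms, of k] nu_gen_shift_first[OF small assms q2, of k]
    by (simp add: h_def algebra_simps power2_eq_square)
  have h_0: "h 0 = q ^ k * qpoch (- q) (q\<^sup>2) k * h k" for k
  proof (induction k)
    case (Suc k)
    \<comment> \<open>The factor \<open>1 + q * (q\<^sup>2) ^ k\<close> is the next factor of
      \<open>qpoch (- q) (q\<^sup>2)\<close>.\<close>
    then show ?case by (subst (asm) h_Suc) (simp add: qpoch_Suc mult_ac)
  qed simp
  define K where "K = exp (1 / (1 - norm q)) * exp (1 / (1 - norm (q\<^sup>2))) / (1 - norm q)
    + exp (norm q / (1 - norm q) / (1 - norm (q\<^sup>2))) / (1 - norm (q\<^sup>2))"
  have h_le: "norm (h k) \<le> K" for k
    unfolding h_def K_def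
    by (intro order.trans[OF norm_triangle_ineq4] add_mono
          norm_suminf_distinct_term_le norm_nu_gen_le small assms q2)
  have "(\<lambda>k. h 0) \<longlonglongrightarrow> 0"
  proof (rule Lim_null_comparison)
    have "norm (h 0) \<le> norm q ^ k * exp (1 / (1 - norm (q\<^sup>2))) * K" for k
      unfolding h_0[of k] norm_mult[of _ "h _"] norm_mult[of _ "qpoch _ _ _"] norm_power[of q k]
      using assms q2 by (intro mult_mono norm_qpoch_le h_le mult_nonneg_nonneg) auto
    then show "\<forall>\<^sub>F k in sequentially. norm (h 0) \<le> norm q ^ k * exp (1 / (1 - norm (q\<^sup>2))) * K"
      by simp
    have "(\<lambda>k. norm q ^ k) \<longlonglongrightarrow> 0"
      using assms by (intro LIMSEQ_power_zero) simp
    then show "(\<lambda>k. norm q ^ k * exp (1 / (1 - norm (q\<^sup>2))) * K) \<longlonglongrightarrow> 0"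
      by (intro tendsto_mult_left_zero)
  qed
  then have "h 0 = 0"
    by (simp add: tendsto_const_iff)
  then show ?thesis
    by (simp add: h_def)
qed

theorem theorem4p1:
  fixes q :: complex
  assumes "norm q < 1"
  shows "(\<lambda>n. q ^ n * qpoch (- (q ^ (n + 1))) q n * qpoch_inf (- (q ^ (2 * n + 2))) (q\<^sup>2))
           sums (q * omega (q\<^sup>2) + qpoch_inf (- (q\<^sup>2)) (q\<^sup>2) * psi (q\<^sup>2))
       \<and> q * omega (q\<^sup>2) + qpoch_inf (- (q\<^sup>2)) (q\<^sup>2) * psi (q\<^sup>2) = nu (- q)"
proof -
  have "distinct_term 1 q sums nu (- q)"
    using summable_sums[OF summable_distinct_term[of 1 q]] assms
    by (simp add: suminf_distinct_term_eq_nu_gen nu_uminus)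
  then show ?thesis
    using nu_eq[OF assms] unfolding distinct_term_def by simp
qed

end
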